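(* For every positive real $\alpha$, the Privacy-Preserving Stackelberg Mechanism (PPSM), viewed as the randomized map $D^F_S \mapsto \hat{D}^F_S$ that takes the follower's sensitive data $D^F_S \in \mathbb{R}_+^n$ as input and outputs the privacy-preserving data $\hat{D}^F_S$, satisfies $\alpha$-indistinguishability.
   Context: **Adjacency and indistinguishability.** Datasets are vectors $D=(d_1,\dots,d_n)$ with $d_i\in\mathbb{R}_+$. For $\alpha>0$, two datasets are adjacent, $D\sim_\alpha D'$, iff there is an index $i$ with $|d_i-d_i'|\le\alpha$ and $d_j=d_j'$ for all $j\neq i$. A randomized mechanism $\mathcal{M}$ with domain the set of datasets and range $\mathscr{R}$ is $\epsilon$-differentially private (with respect to $\sim_\alpha$) if for every $O\subseteq\mathscr{R}$ and all $D\sim_\alpha D'$, $\Pr[\mathcal{M}(D)\in O]\le \exp(\epsilon)\Pr[\mathcal{M}(D')\in O]$. Throughout $\epsilon=1$ is fixed, and this property with $\epsilon=1$ is called $\alpha$-indistinguishability. **Stackelberg game.** The leader has input data $D^L$; the follower has public data $D^F_P$ and sensitive data $D^F_S$. All data other than $D^F_S$, and all problem models and prediction models, are public (they do not depend on $D^F_S$). The follower problem $\mathcal{P}^F(x^L,D^F_P,D^F_S)$ is: minimize $\mathcal{O}^F(x^F,D^F_P,D^F_S)$ over $x^F$ subject to $(x^F,x^L)\in\mathcal{F}^F(D^F_P,D^F_S)$, where $x^L$ is a fixed parameter; its dual variables are denoted $y^F$. The leader problem is: minimize $\mathcal{O}^L(x^L,D^L)$ over $(x^L,y^F)$ subject to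 $(x^L,y^F)\in\mathcal{F}^L(D^L)$ and $y^F$ being a dual solution of $\mathcal{P}^F(x^L,D^F_P,D^F_S)$. The leader has a prediction model $\mathcal{M}^L(D^L,D^F_P,\cdot)$ returning an estimate of the follower dual variables, and the follower has a prediction model $\mathcal{M}^F(x^L,D^F_P,\cdot)$ returning estimates of the follower optimal objective value and of its dual variables. **PPSM**, with fidelity parameters $\eta_p,\eta_d$, performs the following steps. [1] $\tilde{D}^F_S = D^F_S+\mathrm{Lap}(\alpha)^n$, where $\mathrm{Lap}(\lambda)^n$ denotes a vector of $n$ i.i.d. Laplace random variables with mean $0$ and scale $\lambda$. [2a] $\bar{y}^F=\mathcal{M}^L(D^L,D^F_P,\tilde{D}^F_S)$. [2b] $\bar{x}^L=\arg\min_{x^L}\mathcal{O}^L(x^L,D^L)$ subject to $(x^L,\bar{y}^F)\in\mathcal{F}^L(D^L)$. [3a] $(\bar{\mathcal{O}}^{F^*},\bar{y}^{F^*})=\mathcal{M}^F(\bar{x}^L,D^F_P,\tilde{D}^F_S)$. [3b] Output $\hat{D}^F_S$, obtained as a solution of $$\min_{\hat{D}^F_S,\hat{x}^F,\hat{y}^F}\ \|\hat{D}^F_S-\tilde{D}^F_S\|_2^2\quad\text{s.t.}\quad |\hat{\mathcal{O}}^F-\bar{\mathcal{O}}^{F^*}|\le\eta_p,\quad |\hat{y}^F-\bar{y}^{F^*}|\le\eta_d \text{ (componentwise)},\quad \hat{y}^F=\text{dual solution of }\mathcal{P}^F(\bar{x}^L,D^F_P,\hat{D}^F_S),$$ where $\hat{x}^F$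 and $\hat{\mathcal{O}}^F$ are the primal solution and objective value of $\mathcal{P}^F(\bar{x}^L,D^F_P,\hat{D}^F_S)$. Steps [2a]--[3b] use $D^F_S$ only through $\tilde{D}^F_S$. *)

theory Defs
  imports "HOL-Probability.Probability"
begin

section \<open>Differential privacy\<close>

definition datasets :: "(real ^ 'n) set" where
  "datasets = {D. \<forall>i. 0 \<le> D $ i}"

definition adjacent :: "real \<Rightarrow> real ^ 'n \<Rightarrow> real ^ 'n \<Rightarrow> bool" where
  "adjacent \<alpha> D D' \<longleftrightarrow> (\<exists>i. \<bar>D $ i - D' $ i\<bar> \<le> \<alpha> \<and> (\<forall>j. j \<noteq> i \<longrightarrow> D $ j = D' $ j))"

text \<open>
  A randomized mechanism is represented by the distribution of its output: a map from the domain
  \<open>X\<close> to probability measures on a measurable range \<open>R\<close>.  The output events are the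
  sets in \<open>sets R\<close>.
\<close>

definition differentially_private ::
  "real \<Rightarrow> ('d \<Rightarrow> 'd \<Rightarrow> bool) \<Rightarrow> 'd set \<Rightarrow> 'r measure \<Rightarrow> ('d \<Rightarrow> 'r measure) \<Rightarrow> bool" where
  "differentially_private \<epsilon> adj X R M \<longleftrightarrow>
     (\<forall>D\<in>X. M D \<in> space (prob_algebra R)) \<and>
     (\<forall>S\<in>sets R. \<forall>D\<in>X. \<forall>D'\<in>X. adj D D' \<longrightarrow>
        measure (M D) S \<le> exp \<epsilon> * measure (M D') S)"

definition indistinguishable ::
  "real \<Rightarrow> 'r measure \<Rightarrow> (real ^ 'n \<Rightarrow> 'r measure) \<Rightarrow> bool" where
  "indistinguishable \<alpha> R M \<longleftrightarrow> differentially_private 1 (adjacent \<alpha>) datasets R M"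

definition laplace_density :: "real \<Rightarrow> real \<Rightarrow> real" where
  "laplace_density b x = exp (- \<bar>x\<bar> / b) / (2 * b)"

definition laplace :: "real \<Rightarrow> real measure" where
  "laplace b = density lborel (\<lambda>x. ennreal (laplace_density b x))"

definition laplace_vec :: "real \<Rightarrow> (real ^ 'n) measure" where
  "laplace_vec b = distr (Pi\<^sub>M UNIV (\<lambda>_. laplace b)) borel (\<lambda>f. \<chi> i. f i)"


section \<open>Stackelberg games\<close>

text \<open>
  The feasible set of the follower problem is abstract, so the problem does not determine its
  dual by itself.  The game therefore carries a Lagrangian and a set of admissible multipliers,
  which \<open>has_lagrangian\<close> below ties to the primal problem.  The usual
  \<open>f x + y \<bullet> g x\<close>, with \<open>y \<ge> 0\<close> for inequality constraints \<open>g x \<le> 0\<close> and \<open>y\<close>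
  unrestricted for equality constraints, is the standard instance; the value \<open>\<infinity>\<close> encodes
  constraints on \<open>x\<close> that are not dualized.
\<close>

record ('xl, 'xf, 'y, 'dl, 'dp, 'ds) stackelberg_game =
  leader_obj :: "'xl \<Rightarrow> 'dl \<Rightarrow> real"
  leader_feas :: "'dl \<Rightarrow> ('xl \<times> 'y) set"
  follower_obj :: "'xf \<Rightarrow> 'dp \<Rightarrow> 'ds \<Rightarrow> real"
  follower_feas :: "'dp \<Rightarrow> 'ds \<Rightarrow> ('xf \<times> 'xl) set"
  lagrangian :: "'xl \<Rightarrow> 'dp \<Rightarrow> 'ds \<Rightarrow> 'xf \<Rightarrow> 'y \<Rightarrow> ereal"
  multipliers :: "'xl \<Rightarrow> 'dp \<Rightarrow> 'ds \<Rightarrow> 'y set"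

definition has_lagrangian :: "('xl, 'xf, 'y, 'dl, 'dp, 'ds) stackelberg_game \<Rightarrow> bool" where
  "has_lagrangian G \<longleftrightarrow> (\<forall>xL DP DS xF.
     (SUP y\<in>multipliers G xL DP DS. lagrangian G xL DP DS xF y) =
     (if (xF, xL) \<in> follower_feas G DP DS then ereal (follower_obj G xF DP DS) else \<infinity>))"

definition primal_solution ::
  "('xl, 'xf, 'y, 'dl, 'dp, 'ds) stackelberg_game \<Rightarrow> 'xl \<Rightarrow> 'dp \<Rightarrow> 'ds \<Rightarrow> 'xf \<Rightarrow> bool" where
  "primal_solution G xL DP DS xF \<longleftrightarrow>
     is_arg_min (\<lambda>x. follower_obj G x DP DS) (\<lambda>x. (x, xL) \<in> follower_feas G DP DS) xF"

definition dual_obj ::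
  "('xl, 'xf, 'y, 'dl, 'dp, 'ds) stackelberg_game \<Rightarrow> 'xl \<Rightarrow> 'dp \<Rightarrow> 'ds \<Rightarrow> 'y \<Rightarrow> ereal" where
  "dual_obj G xL DP DS y = (INF x. lagrangian G xL DP DS x y)"

definition dual_solution ::
  "('xl, 'xf, 'y, 'dl, 'dp, 'ds) stackelberg_game \<Rightarrow> 'xl \<Rightarrow> 'dp \<Rightarrow> 'ds \<Rightarrow> 'y \<Rightarrow> bool" where
  "dual_solution G xL DP DS y \<longleftrightarrow>
     is_arg_max (dual_obj G xL DP DS) (\<lambda>y. y \<in> multipliers G xL DP DS) y \<and>
     \<bar>dual_obj G xL DP DS y\<bar> \<noteq> \<infinity>"


section \<open>The mechanism\<close>

definition leader_solution ::
  "('xl, 'xf, 'y, 'dl, 'dp, 'ds) stackelberg_game \<Rightarrow> 'dl \<Rightarrow> 'y \<Rightarrow> 'xl \<Rightarrow> bool" where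
  "leader_solution G DL y xL \<longleftrightarrow>
     is_arg_min (\<lambda>x. leader_obj G x DL) (\<lambda>x. (x, y) \<in> leader_feas G DL) xL"

definition fidelity_solution ::
  "('xl, 'xf, real ^ 'm, 'dl, 'dp, real ^ 'n) stackelberg_game \<Rightarrow> 'dp \<Rightarrow> real \<Rightarrow> real \<Rightarrow>
   'xl \<Rightarrow> real \<Rightarrow> real ^ 'm \<Rightarrow> real ^ 'n \<Rightarrow> (real ^ 'n) \<times> 'xf \<times> (real ^ 'm) \<Rightarrow> bool" where
  "fidelity_solution G DP \<eta>p \<eta>d xL obj y0 D0 z \<longleftrightarrow>
     is_arg_min (\<lambda>(D, x, y). (norm (D - D0))\<^sup>2)
       (\<lambda>(D, x, y).
          \<bar>follower_obj G x DP D - obj\<bar> \<le> \<eta>p \<and>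
          (\<forall>k. \<bar>y $ k - y0 $ k\<bar> \<le> \<eta>d) \<and>
          dual_solution G xL DP D y \<and>
          primal_solution G xL DP D x) z"

text \<open>
  The optimization steps need not have unique solutions, so they are carried out by solvers:
  functions of the problem instance that return some solution whenever there is one.
  On unsolvable instances their value is unconstrained.
\<close>

definition leader_solver ::
  "('xl, 'xf, 'y, 'dl, 'dp, 'ds) stackelberg_game \<Rightarrow> 'dl \<Rightarrow> ('y \<Rightarrow> 'xl) \<Rightarrow> bool" where
  "leader_solver G DL s \<longleftrightarrow>
     (\<forall>y. (\<exists>xL. leader_solution G DL y xL) \<longrightarrow> leader_solution G DL y (s y))"

definition fidelity_solver ::
  "('xl, 'xf, real ^ 'm, 'dl, 'dp, real ^ 'n) stackelberg_game \<Rightarrow> 'dp \<Rightarrow> real \<Rightarrow> real \<Rightarrow>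
   ('xl \<Rightarrow> real \<Rightarrow> real ^ 'm \<Rightarrow> real ^ 'n \<Rightarrow> (real ^ 'n) \<times> 'xf \<times> (real ^ 'm)) \<Rightarrow> bool" where
  "fidelity_solver G DP \<eta>p \<eta>d s \<longleftrightarrow>
     (\<forall>xL obj y0 D0. (\<exists>z. fidelity_solution G DP \<eta>p \<eta>d xL obj y0 D0 z) \<longrightarrow>
        fidelity_solution G DP \<eta>p \<eta>d xL obj y0 D0 (s xL obj y0 D0))"

text \<open>
  \<open>predL\<close> and \<open>predF\<close> are the prediction models of the leader and of the follower, \<open>sL\<close> and \<open>sF\<close> the
  two solvers.  The game and the fidelity parameters enter through the requirements on the solvers.
\<close>

definition ppsm_post ::
  "('dl \<Rightarrow> 'dp \<Rightarrow> 'ds \<Rightarrow> 'y) \<Rightarrow> ('xl \<Rightarrow> 'dp \<Rightarrow> 'ds \<Rightarrow> real \<times> 'y) \<Rightarrow>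
   ('y \<Rightarrow> 'xl) \<Rightarrow> ('xl \<Rightarrow> real \<Rightarrow> 'y \<Rightarrow> 'ds \<Rightarrow> 'ds \<times> 'xf \<times> 'y) \<Rightarrow>
   'dl \<Rightarrow> 'dp \<Rightarrow> 'ds \<Rightarrow> 'ds" where
  "ppsm_post predL predF sL sF DL DP D0 =
     (let yF = predL DL DP D0;
          xL = sL yF;
          (obj, y0) = predF xL DP D0;
          (D, x, y) = sF xL obj y0 D0
      in D)"

definition ppsm ::
  "real \<Rightarrow> (real ^ 'n) measure \<Rightarrow>
   ('dl \<Rightarrow> 'dp \<Rightarrow> real ^ 'n \<Rightarrow> 'y) \<Rightarrow> ('xl \<Rightarrow> 'dp \<Rightarrow> real ^ 'n \<Rightarrow> real \<times> 'y) \<Rightarrow>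
   ('y \<Rightarrow> 'xl) \<Rightarrow> ('xl \<Rightarrow> real \<Rightarrow> 'y \<Rightarrow> real ^ 'n \<Rightarrow> (real ^ 'n) \<times> 'xf \<times> 'y) \<Rightarrow>
   'dl \<Rightarrow> 'dp \<Rightarrow> real ^ 'n \<Rightarrow> (real ^ 'n) measure" where
  "ppsm \<alpha> R predL predF sL sF DL DP DS =
     distr (laplace_vec \<alpha>) R (\<lambda>z. ppsm_post predL predF sL sF DL DP (DS + z))"

end

theory Submission
  imports Defs
begin

text \<open>
  The mechanism touches the sensitive data only once, when it adds Laplace noise; the prediction
  models and the two solvers then form one fixed measurable function of the noisy data.
  Differential privacy survives such post-processing, because an event about the output is, by
  taking preimages, an event about the noisy data (\<open>differentially_private_post_processing\<close>).

  It remains to see that the noisy data themselves are private.  Adjacent datasets differ in a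
  single coordinate, and the coordinates of the noise are independent, so by Fubini's theorem
  (\<open>laplace_vec_shift_coordinate\<close>) it is enough to look at one real coordinate whose centre moves by
  at most \<open>\<alpha>\<close>.  There the triangle inequality bounds the quotient of the two Laplace densities by
  \<open>exp (\<alpha> / b)\<close> (\<open>nn_integral_laplace_shift_le\<close>), and with scale \<open>b = \<alpha>\<close> the exponent is \<open>1\<close>.
\<close>

section \<open>The Laplace distribution on the line\<close>

lemma borel_measurable_laplace_density [measurable]: "laplace_density b \<in> borel_measurable borel"
  unfolding laplace_density_def by measurable

lemma sets_laplace [measurable_cong, simp]: "sets (laplace b) = sets borel"
  by (simp add: laplace_def)

lemma laplace_density_nonneg: "b > 0 \<Longrightarrow> 0 \<le> laplace_density b x"
  by (simp add: laplace_density_def)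

text \<open>
  Away from the origin the Laplace density is the average of the exponential density with rate
  \<open>1 / b\<close> and its mirror image, so its total mass comes from that of the exponential distribution.
\<close>

lemma prob_space_laplace:
  assumes "b > 0"
  shows "prob_space (laplace b)"
proof
  let ?e = "\<lambda>x. ennreal (exponential_density (1 / b) x)"
  have exp1: "(\<integral>\<^sup>+x. ?e x \<partial>lborel) = 1"
    using prob_space.emeasure_space_1[OF prob_space_exponential_density, of "1 / b"] assms
    by (simp add: emeasure_density)
  have exp2: "(\<integral>\<^sup>+x. ?e (- x) \<partial>lborel) = 1"
    using nn_integral_real_affine[of ?e "-1" 0] exp1 by simp
  have "AE x in lborel. (x::real) \<noteq> 0"
    by (rule AE_lborel_singleton)
  then have "AE x in lborel. ennreal (laplace_density b x) = ennreal (1 / 2) * (?e x + ?e (- x))"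
  proof (rule AE_mp, intro AE_I2 impI)
    fix x :: real
    assume "x \<noteq> 0"
    then have "laplace_density b x
        = 1 / 2 * (exponential_density (1 / b) x + exponential_density (1 / b) (- x))"
      using assms by (auto simp: laplace_density_def exponential_density_def)
    moreover have "0 \<le> exponential_density (1 / b) y" for y
      using assms by (simp add: exponential_density_def)
    ultimately show "ennreal (laplace_density b x) = ennreal (1 / 2) * (?e x + ?e (- x))"
      by (simp only: ennreal_mult ennreal_plus add_nonneg_nonneg zero_le_divide_1_iff zero_le_numeral)
  qed
  then have "(\<integral>\<^sup>+x. ennreal (laplace_density b x) \<partial>lborel)
      = (\<integral>\<^sup>+x. ennreal (1 / 2) * (?e x + ?e (- x)) \<partial>lborel)"
    by (rule nn_integral_cong_AE)
  also have "\<dots> = ennreal (1 / 2) * (1 + 1)"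
    by (subst nn_integral_cmult, measurable, subst nn_integral_add) (simp_all add: exp1 exp2)
  also have "\<dots> = ennreal (1 / 2) * ennreal 2"
    by simp
  also have "\<dots> = 1"
    by (subst ennreal_mult[symmetric]) simp_all
  finally show "emeasure (laplace b) (space (laplace b)) = 1"
    by (simp add: laplace_def emeasure_density)
qed

lemma laplace_density_shift_le:
  assumes "b > 0"
  shows "laplace_density b (x - d) \<le> exp (\<bar>d\<bar> / b) * laplace_density b x"
proof -
  have "- \<bar>x - d\<bar> / b \<le> \<bar>d\<bar> / b + - \<bar>x\<bar> / b"
    using assms by (simp add: field_simps)
  then have "exp (- \<bar>x - d\<bar> / b) \<le> exp (\<bar>d\<bar> / b) * exp (- \<bar>x\<bar> / b)"
    by (simp flip: exp_add)
  then show ?thesis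
    using assms by (simp add: laplace_density_def divide_right_mono)
qed

text \<open>
  Translating the argument of \<open>h\<close> amounts, since Lebesgue measure is translation invariant, to
  translating the density the other way.
\<close>

lemma nn_integral_laplace_shift_le:
  assumes b: "b > 0" and [measurable]: "h \<in> borel_measurable borel"
  shows "(\<integral>\<^sup>+x. h (d + x) \<partial>laplace b) \<le> ennreal (exp (\<bar>d\<bar> / b)) * (\<integral>\<^sup>+x. h x \<partial>laplace b)"
proof -
  have "(\<integral>\<^sup>+x. h (d + x) \<partial>laplace b)
      = (\<integral>\<^sup>+x. ennreal (laplace_density b x) * h (d + x) \<partial>lborel)"
    by (simp add: laplace_def nn_integral_density)
  also have "\<dots> = (\<integral>\<^sup>+x. ennreal (laplace_density b (x - d)) * h x \<partial>lborel)"
    by (subst nn_integral_real_affine[where c = 1 and t = "- d"]) (simp_all add: algebra_simps)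
  also have "\<dots> \<le> (\<integral>\<^sup>+x. ennreal (exp (\<bar>d\<bar> / b)) * (ennreal (laplace_density b x) * h x) \<partial>lborel)"
  proof (intro nn_integral_mono)
    fix x
    have "ennreal (laplace_density b (x - d))
        \<le> ennreal (exp (\<bar>d\<bar> / b)) * ennreal (laplace_density b x)"
      using laplace_density_shift_le[OF b] laplace_density_nonneg[OF b]
      by (simp add: ennreal_leI flip: ennreal_mult)
    then show "ennreal (laplace_density b (x - d)) * h x
        \<le> ennreal (exp (\<bar>d\<bar> / b)) * (ennreal (laplace_density b x) * h x)"
      by (simp add: mult_right_mono flip: mult.assoc)
  qed
  also have "\<dots> = ennreal (exp (\<bar>d\<bar> / b)) * (\<integral>\<^sup>+x. h x \<partial>laplace b)"
    by (simp add: laplace_def nn_integral_density nn_integral_cmult)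
  finally show ?thesis .
qed

section \<open>Laplace noise on vectors\<close>

lemma borel_measurable_vec_lambda:
  fixes f :: "'a \<Rightarrow> 'n::finite \<Rightarrow> real"
  assumes "\<And>i. (\<lambda>x. f x i) \<in> borel_measurable M"
  shows "(\<lambda>x. \<chi> i. f x i) \<in> borel_measurable M"
proof (subst borel_measurable_euclidean_space, intro ballI)
  fix v :: "real ^ 'n"
  assume "v \<in> Basis"
  then obtain i where "v = axis i 1"
    by (auto simp: Basis_vec_def)
  then show "(\<lambda>x. (\<chi> i. f x i) \<bullet> v) \<in> borel_measurable M"
    using assms[of i] by (simp add: inner_axis)
qed

lemma measurable_vec_lambda_PiM [measurable]:
  "(\<lambda>f. \<chi> i. f i) \<in> Pi\<^sub>M UNIV (\<lambda>_. laplace b) \<rightarrow>\<^sub>M (borel :: (real ^ 'n) measure)"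
  by (rule borel_measurable_vec_lambda) measurable

lemma sets_laplace_vec [measurable_cong, simp]: "sets (laplace_vec b) = sets borel"
  by (simp add: laplace_vec_def)

lemma prob_space_laplace_vec:
  assumes "b > 0"
  shows "prob_space (laplace_vec b :: (real ^ 'n) measure)"
  unfolding laplace_vec_def
  by (intro prob_space.prob_space_distr prob_space_PiM prob_space_laplace assms) measurable

text \<open>
  Integrating the \<open>i\<close>-th coordinate first, with the others held fixed, leaves a one-dimensional
  integral to which the bound on the line applies.
\<close>

lemma laplace_vec_shift_coordinate:
  fixes h :: "real ^ 'n \<Rightarrow> ennreal"
  assumes b: "b > 0" and [measurable]: "h \<in> borel_measurable borel"
  shows "(\<integral>\<^sup>+z. h (axis i d + z) \<partial>laplace_vec b)
      \<le> ennreal (exp (\<bar>d\<bar> / b)) * (\<integral>\<^sup>+z. h z \<partial>laplace_vec b)"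
proof -
  interpret L: prob_space "laplace b"
    using b by (rule prob_space_laplace)
  interpret P: product_sigma_finite "\<lambda>_::'n. laplace b"
    by standard
  let ?I = "UNIV - {i}"
  have slice: "(\<lambda>t. h (\<chi> j. (f(i := t)) j)) \<in> borel_measurable borel" for f :: "'n \<Rightarrow> real"
    by (intro measurable_compose[OF _ assms(2)] borel_measurable_vec_lambda) simp
  have fubini: "(\<integral>\<^sup>+z. g z \<partial>laplace_vec b)
      = (\<integral>\<^sup>+f. (\<integral>\<^sup>+t. g (\<chi> j. (f(i := t)) j) \<partial>laplace b) \<partial>Pi\<^sub>M ?I (\<lambda>_. laplace b))"
    if [measurable]: "g \<in> borel_measurable borel" for g :: "real ^ 'n \<Rightarrow> ennreal"
  proof -
    have "insert i ?I = UNIV"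
      by auto
    then show ?thesis
      using P.product_nn_integral_insert[of ?I i "\<lambda>f. g (\<chi> j. f j)"]
      by (simp add: laplace_vec_def nn_integral_distr)
  qed
  have shift: "axis i d + (\<chi> j. (f(i := t)) j) = (\<chi> j. (f(i := d + t)) j)" for f t
    by (simp add: vec_eq_iff axis_def)
  let ?c = "ennreal (exp (\<bar>d\<bar> / b))"
  \<comment> \<open>The factor stays under the integral, so that the right-hand side is again a slice of a function
    of the whole vector and Fubini can be undone.\<close>
  have inner: "(\<integral>\<^sup>+t. h (axis i d + (\<chi> j. (f(i := t)) j)) \<partial>laplace b)
      \<le> (\<integral>\<^sup>+t. ?c * h (\<chi> j. (f(i := t)) j) \<partial>laplace b)" for f
    using nn_integral_laplace_shift_le[OF b slice, of f d] slice[of f]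
    unfolding shift by (subst nn_integral_cmult) (simp_all add: fun_upd_def cong: measurable_cong_sets)
  have "(\<integral>\<^sup>+z. h (axis i d + z) \<partial>laplace_vec b) \<le> (\<integral>\<^sup>+z. ?c * h z \<partial>laplace_vec b)"
    by (subst (1 2) fubini, measurable) (intro nn_integral_mono inner)
  also have "\<dots> = ?c * (\<integral>\<^sup>+z. h z \<partial>laplace_vec b)"
    by (rule nn_integral_cmult) measurable
  finally show ?thesis .
qed

section \<open>Differential privacy\<close>

lemma differentially_private_post_processing:
  assumes priv: "differentially_private \<epsilon> adj X R M" and f: "f \<in> R \<rightarrow>\<^sub>M R'"
  shows "differentially_private \<epsilon> adj X R' (\<lambda>D. distr (M D) R' f)"
  unfolding differentially_private_def
proof (intro conjI ballI impI)
  have M: "M D \<in> space (prob_algebra R)" if "D \<in> X" for D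
    using priv that by (auto simp: differentially_private_def)
  have fM: "f \<in> M D \<rightarrow>\<^sub>M R'" if "D \<in> X" for D
    using M[OF that] f by (simp add: space_prob_algebra cong: measurable_cong_sets)
  fix D
  assume D: "D \<in> X"
  show "distr (M D) R' f \<in> space (prob_algebra R')"
    using M[OF D] fM[OF D] by (simp add: space_prob_algebra prob_space.prob_space_distr)
  fix S D'
  assume S: "S \<in> sets R'" and D': "D' \<in> X" and "adj D D'"
  have space: "space (M C) = space R" if "C \<in> X" for C
    using M[OF that] by (auto simp: space_prob_algebra dest: sets_eq_imp_space_eq)
  have "f -` S \<inter> space R \<in> sets R"
    using f S by (rule measurable_sets)
  then have "measure (M D) (f -` S \<inter> space R) \<le> exp \<epsilon> * measure (M D') (f -` S \<inter> space R)"
    using priv D D' \<open>adj D D'\<close> by (simp add: differentially_private_def)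
  then show "measure (distr (M D) R' f) S \<le> exp \<epsilon> * measure (distr (M D') R' f) S"
    using fM S D D' by (simp add: measure_distr space)
qed

lemma adjacent_imp_shift_coordinate:
  assumes "adjacent \<alpha> D D'"
  obtains i d where "D = axis i d + D'" and "\<bar>d\<bar> \<le> \<alpha>"
proof -
  from assms obtain i where i: "\<bar>D $ i - D' $ i\<bar> \<le> \<alpha>" "\<And>j. j \<noteq> i \<Longrightarrow> D $ j = D' $ j"
    by (auto simp: adjacent_def)
  then have "D = axis i (D $ i - D' $ i) + D'"
    by (simp add: vec_eq_iff axis_def)
  with i(1) show ?thesis
    by (rule that[rotated])
qed

lemma differentially_private_laplace_vec:
  fixes X :: "(real ^ 'n) set"
  assumes b: "b > 0"
  shows "differentially_private (\<alpha> / b) (adjacent \<alpha>) X borel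
    (\<lambda>D. distr (laplace_vec b) borel (\<lambda>z. D + z))"
  unfolding differentially_private_def
proof (intro conjI ballI impI)
  interpret L: prob_space "laplace_vec b :: (real ^ 'n) measure"
    using b by (rule prob_space_laplace_vec)
  fix D :: "real ^ 'n"
  have prob: "prob_space (distr (laplace_vec b) borel (\<lambda>z. C + z))" for C :: "real ^ 'n"
    by (rule L.prob_space_distr) measurable
  then show "distr (laplace_vec b) borel (\<lambda>z. D + z) \<in> space (prob_algebra borel)"
    by (simp add: space_prob_algebra)
  fix S :: "(real ^ 'n) set" and D' :: "real ^ 'n"
  assume S [measurable]: "S \<in> sets borel" and "adjacent \<alpha> D D'"
  obtain i d where D: "D = axis i d + D'" and d: "\<bar>d\<bar> \<le> \<alpha>"
    using \<open>adjacent \<alpha> D D'\<close> by (rule adjacent_imp_shift_coordinate)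
  have emeasure_eq: "emeasure (distr (laplace_vec b) borel (\<lambda>z. C + z)) S
      = (\<integral>\<^sup>+z. indicator S (C + z) \<partial>laplace_vec b)" for C :: "real ^ 'n"
    by (subst nn_integral_indicator[symmetric], simp, subst nn_integral_distr) simp_all
  have "emeasure (distr (laplace_vec b) borel (\<lambda>z. D + z)) S
      = (\<integral>\<^sup>+z. indicator S (D' + (axis i d + z)) \<partial>laplace_vec b)"
    unfolding emeasure_eq by (simp add: D ac_simps)
  also have "\<dots> \<le> ennreal (exp (\<bar>d\<bar> / b)) * (\<integral>\<^sup>+z. indicator S (D' + z) \<partial>laplace_vec b)"
    by (rule laplace_vec_shift_coordinate[OF b, where h = "\<lambda>z. indicator S (D' + z)"]) measurable
  also have "\<dots> \<le> ennreal (exp (\<alpha> / b)) * (\<integral>\<^sup>+z. indicator S (D' + z) \<partial>laplace_vec b)"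
    using d b by (intro mult_right_mono ennreal_leI) (simp_all add: divide_right_mono)
  finally have le: "emeasure (distr (laplace_vec b) borel (\<lambda>z. D + z)) S
      \<le> ennreal (exp (\<alpha> / b)) * emeasure (distr (laplace_vec b) borel (\<lambda>z. D' + z)) S"
    unfolding emeasure_eq .
  interpret A: prob_space "distr (laplace_vec b) borel (\<lambda>z. D + z)"
    by (rule prob)
  interpret B: prob_space "distr (laplace_vec b) borel (\<lambda>z. D' + z)"
    by (rule prob)
  from le show "measure (distr (laplace_vec b) borel (\<lambda>z. D + z)) S
      \<le> exp (\<alpha> / b) * measure (distr (laplace_vec b) borel (\<lambda>z. D' + z)) S"
    by (simp add: A.emeasure_eq_measure B.emeasure_eq_measure flip: ennreal_mult)
qed

theorem theorem3:
  fixes \<alpha> \<eta>p \<eta>d :: real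
    and G :: "('xl, 'xf, real ^ 'm, 'dl, 'dp, real ^ 'n) stackelberg_game"
    and DL :: 'dl and DP :: 'dp
    and predL :: "'dl \<Rightarrow> 'dp \<Rightarrow> real ^ 'n \<Rightarrow> real ^ 'm"
    and predF :: "'xl \<Rightarrow> 'dp \<Rightarrow> real ^ 'n \<Rightarrow> real \<times> (real ^ 'm)"
    and sL :: "real ^ 'm \<Rightarrow> 'xl"
    and sF :: "'xl \<Rightarrow> real \<Rightarrow> real ^ 'm \<Rightarrow> real ^ 'n \<Rightarrow> (real ^ 'n) \<times> 'xf \<times> (real ^ 'm)"
    and R :: "(real ^ 'n) measure"
  assumes "\<alpha> > 0"
    and "has_lagrangian G"
    and "leader_solver G DL sL"
    and "fidelity_solver G DP \<eta>p \<eta>d sF"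
    and "ppsm_post predL predF sL sF DL DP \<in> borel \<rightarrow>\<^sub>M R"
  shows "indistinguishable \<alpha> R (ppsm \<alpha> R predL predF sL sF DL DP)"
proof -
  let ?post = "ppsm_post predL predF sL sF DL DP"
  have "ppsm \<alpha> R predL predF sL sF DL DP
      = (\<lambda>D. distr (distr (laplace_vec \<alpha>) borel (\<lambda>z. D + z)) R ?post)"
    using assms(5) by (simp add: ppsm_def fun_eq_iff distr_distr comp_def)
  moreover have "differentially_private (\<alpha> / \<alpha>) (adjacent \<alpha>) datasets borel
      (\<lambda>D :: real ^ 'n. distr (laplace_vec \<alpha>) borel (\<lambda>z. D + z))"
    using assms(1) by (rule differentially_private_laplace_vec)
  ultimately show ?thesis
    using assms(1,5) differentially_private_post_processing
    by (auto simp: indistinguishable_def)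
qed

end
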